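(* Let $\kappa\ge0$ and let $(Y,d)$ be a $(1,\kappa)$-quasi-geodesic space satisfying Axioms 1' and 3' (with respect to a metric space $(\overline{Y},\overline{d})$, $\partial Y=\overline{Y}\setminus Y$). If $f:Y\rightarrow Y$ is a compact nonexpansive mapping without bounded orbits, then there exists $\xi\in\partial Y$ such that the iterates $f^{n}$ of $f$ converge uniformly on bounded sets of $Y$ to $\xi$.
   Context: Metric spaces are nonempty. Axiom 1': $(Y,d)$ is an open dense subset of a metric space $(\overline{Y},\overline{d})$ (not necessarily compact) whose relative topology coincides with the topology of $(Y,d)$; and for any $w\in Y$, if $\{x_n\}$ is a sequence in $Y$ converging (in $\overline{Y}$) to some $\xi\in\partial Y=\overline{Y}\setminus Y$, then $d(x_n,w)\to\infty$. Axiom 3': if $\{x_n\}$ and $\{y_n\}$ are sequences in $Y$, $x_n\to\xi\in\partial Y$, $y_n\to\eta\in\partial Y$, and if for some $w\in Y$, $d(x_n,y_n)-d(y_n,w)\to-\infty$, then $\xi=\eta$. A $(1,\kappa)$-quasi-geodesic is a curve $\gamma:[a,b]\to Y$ with $|t_1-t_2|-\kappa\le d(\gamma(t_1),\gamma(t_2))\le|t_1-t_2|+\kappa$ for all $t_1,t_2\in[a,b]$; $Y$ is $(1,\kappa)$-quasi-geodesic if every pair of points of $Y$ can be connected by a $(1,\kappa)$-quasi-geodesic. $f$ is nonexpansive if $d(f(x),f(y))\le d(x,y)$ for all $x,y\in Y$; $f$ is compact if the $\overline{d}$-closure of $f(Y)$ is compact in $(\overline{Y},\overline{d})$. The orbit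 of $x$ is $\{f^n(x):n=1,2,\ldots\}$; "without bounded orbits" means no orbit is bounded in $(Y,d)$. Uniform convergence on bounded sets to $\xi$ means: for each $d$-bounded $K\subset Y$, $\sup_{y\in K}\overline{d}(f^n(y),\xi)\to 0$. *)

theory Defs
  imports "HOL-Analysis.Analysis"
begin

text \<open>Throughout, \<open>(Y, d)\<close> is a metric space in the sense of \<^locale>\<open>Metric_space\<close> and \<open>(Yb, db)\<close>
  is a second metric space with \<open>Y \<subseteq> Yb\<close>, in which \<open>Y\<close> has the boundary \<open>Yb - Y\<close>.  The metric
  \<open>db\<close> need not restrict to \<open>d\<close> on \<open>Y\<close>.\<close>

definition axiom1 :: "'a set \<Rightarrow> ('a \<Rightarrow> 'a \<Rightarrow> real) \<Rightarrow> 'a set \<Rightarrow> ('a \<Rightarrow> 'a \<Rightarrow> real) \<Rightarrow> bool" where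
  "axiom1 Y d Yb db \<longleftrightarrow>
     openin (Metric_space.mtopology Yb db) Y \<and>
     Metric_space.mtopology Yb db closure_of Y = Yb \<and>
     subtopology (Metric_space.mtopology Yb db) Y = Metric_space.mtopology Y d \<and>
     (\<forall>w\<in>Y. \<forall>x::nat \<Rightarrow> 'a. \<forall>\<xi>\<in>Yb - Y.
        range x \<subseteq> Y \<longrightarrow> limitin (Metric_space.mtopology Yb db) x \<xi> sequentially \<longrightarrow>
        filterlim (\<lambda>n. d (x n) w) at_top sequentially)"

definition axiom3 :: "'a set \<Rightarrow> ('a \<Rightarrow> 'a \<Rightarrow> real) \<Rightarrow> 'a set \<Rightarrow> ('a \<Rightarrow> 'a \<Rightarrow> real) \<Rightarrow> bool" where
  "axiom3 Y d Yb db \<longleftrightarrow>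
     (\<forall>(x::nat \<Rightarrow> 'a) (y::nat \<Rightarrow> 'a). \<forall>\<xi>\<in>Yb - Y. \<forall>\<eta>\<in>Yb - Y.
        range x \<subseteq> Y \<longrightarrow> range y \<subseteq> Y \<longrightarrow>
        limitin (Metric_space.mtopology Yb db) x \<xi> sequentially \<longrightarrow>
        limitin (Metric_space.mtopology Yb db) y \<eta> sequentially \<longrightarrow>
        (\<exists>w\<in>Y. filterlim (\<lambda>n. d (x n) (y n) - d (y n) w) at_bot sequentially) \<longrightarrow>
        \<xi> = \<eta>)"

text \<open>A \<open>(1, \<kappa>)\<close>-quasi-geodesic on \<open>{a..b}\<close>.  Only the metric inequalities are imposed on the curve
  \<open>\<gamma>\<close>; it is not assumed to be continuous, so curves that are continuous in addition are a special
  case.\<close>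

definition quasi_geodesic ::
    "'a set \<Rightarrow> ('a \<Rightarrow> 'a \<Rightarrow> real) \<Rightarrow> real \<Rightarrow> real \<Rightarrow> real \<Rightarrow> (real \<Rightarrow> 'a) \<Rightarrow> bool" where
  "quasi_geodesic Y d \<kappa> a b \<gamma> \<longleftrightarrow>
     a \<le> b \<and> \<gamma> ` {a..b} \<subseteq> Y \<and>
     (\<forall>t\<^sub>1\<in>{a..b}. \<forall>t\<^sub>2\<in>{a..b}.
        \<bar>t\<^sub>1 - t\<^sub>2\<bar> - \<kappa> \<le> d (\<gamma> t\<^sub>1) (\<gamma> t\<^sub>2) \<and> d (\<gamma> t\<^sub>1) (\<gamma> t\<^sub>2) \<le> \<bar>t\<^sub>1 - t\<^sub>2\<bar> + \<kappa>)"

definition quasi_geodesic_space :: "'a set \<Rightarrow> ('a \<Rightarrow> 'a \<Rightarrow> real) \<Rightarrow> real \<Rightarrow> bool" where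
  "quasi_geodesic_space Y d \<kappa> \<longleftrightarrow>
     (\<forall>x\<in>Y. \<forall>y\<in>Y. \<exists>a b \<gamma>. quasi_geodesic Y d \<kappa> a b \<gamma> \<and> \<gamma> a = x \<and> \<gamma> b = y)"

definition nonexpansive :: "'a set \<Rightarrow> ('a \<Rightarrow> 'a \<Rightarrow> real) \<Rightarrow> ('a \<Rightarrow> 'a) \<Rightarrow> bool" where
  "nonexpansive Y d f \<longleftrightarrow> (\<forall>x\<in>Y. \<forall>y\<in>Y. d (f x) (f y) \<le> d x y)"

definition compact_mapping :: "'a set \<Rightarrow> 'a set \<Rightarrow> ('a \<Rightarrow> 'a \<Rightarrow> real) \<Rightarrow> ('a \<Rightarrow> 'a) \<Rightarrow> bool" where
  "compact_mapping Y Yb db f \<longleftrightarrow>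
     compactin (Metric_space.mtopology Yb db) (Metric_space.mtopology Yb db closure_of (f ` Y))"

definition orbit :: "('a \<Rightarrow> 'a) \<Rightarrow> 'a \<Rightarrow> 'a set" where
  "orbit f x = {(f ^^ n) x | n. n \<ge> 1}"

definition without_bounded_orbits :: "'a set \<Rightarrow> ('a \<Rightarrow> 'a \<Rightarrow> real) \<Rightarrow> ('a \<Rightarrow> 'a) \<Rightarrow> bool" where
  "without_bounded_orbits Y d f \<longleftrightarrow> (\<forall>x\<in>Y. \<not> Metric_space.mbounded Y d (orbit f x))"

text \<open>The supremum is taken in \<^typ>\<open>ennreal\<close>, where it is \<open>\<infinity>\<close> on unbounded families and \<open>0\<close> on the
  empty one; on \<^typ>\<open>real\<close> both would be unspecified.\<close>

definition iterates_converge_uniformly_on_bounded ::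
    "'a set \<Rightarrow> ('a \<Rightarrow> 'a \<Rightarrow> real) \<Rightarrow> ('a \<Rightarrow> 'a \<Rightarrow> real) \<Rightarrow> ('a \<Rightarrow> 'a) \<Rightarrow> 'a \<Rightarrow> bool" where
  "iterates_converge_uniformly_on_bounded Y d db f \<xi> \<longleftrightarrow>
     (\<forall>K. Metric_space.mbounded Y d K \<longrightarrow>
        (\<lambda>n. SUP y\<in>K. ennreal (db ((f ^^ n) y) \<xi>)) \<longlonglongrightarrow> 0)"

end

theory Submission
  imports Defs
begin

text \<open>
  Everything follows from one principle, \<open>image_sequence_follows\<close>.  Suppose a sequence \<open>x\<close> in \<open>Y\<close>
  converges to \<open>\<xi>\<close> in the boundary, and a sequence \<open>y\<close> in the image \<open>f ` Y\<close> is so near to it that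
  \<open>d (x n) (y n) - d (x n) w\<close> tends to \<open>-\<infinity>\<close>.  Then \<open>y\<close> is forced to converge to \<open>\<xi>\<close> as well:
  compactness of \<open>f\<close> provides subsequential limits, these lie on the boundary because \<open>y\<close> leaves
  every bounded set, and there Axiom 3' identifies them.

  An orbit \<open>x\<^sub>n = f\<^sup>n x\<close> is handled with two ideas.  First, by a theorem of Calka, an orbit which
  returns infinitely often to some bounded set is bounded, provided bounded subsets of the image are
  relatively compact in \<open>Y\<close>; hence \<open>a n = d x\<^sub>n x\<close> tends to infinity
  (\<open>nonexpansive_orbit_bounded_or_divergent\<close>), and all limit points of the orbit are on the boundary.
  Secondly, as in an argument of Karlsson, let \<open>N\<close> be a record time of \<open>a\<close>, so that \<open>a m \<le> a N\<close> for
  \<open>m < N\<close>.  For \<open>0 < k < N\<close> we have \<open>d x\<^sub>N x\<^sub>k \<le> a (N - k) \<le> a N\<close>, so the doubled Gromov product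
  \<open>a N + a k - d x\<^sub>N x\<^sub>k\<close> is at least \<open>a k\<close>.  It thus tends to infinity along any subsequence of the
  orbit paired with suitable record times.

  Axiom 3' by itself says nothing about large Gromov products; quasi-geodesics bridge the gap
  (\<open>gromov_product_unbounded_imp_same_limit\<close>).  On a quasi-geodesic from \<open>x\<close> to \<open>y\<close> there is a point
  \<open>z\<close> which is nearer to \<open>x\<close> than \<open>w\<close> is, and nearer to \<open>y\<close> than \<open>w\<close> is, by about the Gromov
  product in both cases.  The intermediate points may fail to accumulate anywhere, but their images
  \<open>f z\<close> lie in a relatively compact set, and by the principle above these images converge both to the
  limit of the \<open>x\<close> and to the limit of the \<open>y\<close>.  So all limit points of the orbit agree with the limit
  along record times, and the orbit converges (\<open>orbit_converges_to_boundary\<close>).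

  Finally, points starting in a bounded set stay within bounded distance of the orbit, so the same
  principle carries convergence over to them, uniformly.
\<close>

section \<open>Orbits of nonexpansive maps\<close>

lemma (in Metric_space) limitin_eventually_dist_less:
  assumes "limitin mtopology x l F" and "\<epsilon> > 0"
  shows "\<forall>\<^sub>F n in F. d (x n) l < \<epsilon>"
proof -
  have "\<forall>\<^sub>F n in F. x n \<in> M \<and> d (x n) l < \<epsilon>"
    using assms unfolding limitin_metric by blast
  then show ?thesis by (rule eventually_mono) blast
qed

lemma funpow_closed:
  assumes "f ` A \<subseteq> A" and "x \<in> A"
  shows "(f ^^ n) x \<in> A"
  using assms by (induction n) auto

lemma (in Metric_space) nonexpansive_funpow:
  assumes "f ` M \<subseteq> M" and "nonexpansive M d f" and "x \<in> M" and "y \<in> M"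
  shows "d ((f ^^ n) x) ((f ^^ n) y) \<le> d x y"
proof (induction n)
  case (Suc n)
  have "d (f ((f ^^ n) x)) (f ((f ^^ n) y)) \<le> d ((f ^^ n) x) ((f ^^ n) y)"
    using assms(2) funpow_closed[OF assms(1,3)] funpow_closed[OF assms(1,4)]
    unfolding nonexpansive_def by blast
  with Suc show ?case by simp
qed simp

lemma (in Metric_space) nonexpansive_orbit_shift:
  assumes "f ` M \<subseteq> M" and "nonexpansive M d f" and "x \<in> M"
  shows "d ((f ^^ (i + n)) x) ((f ^^ (j + n)) x) \<le> d ((f ^^ i) x) ((f ^^ j) x)"
proof -
  have "(f ^^ (k + n)) x = (f ^^ n) ((f ^^ k) x)" for k
    by (simp add: add.commute[of k n] funpow_add)
  then show ?thesis
    using nonexpansive_funpow[OF assms(1,2)] funpow_closed[OF assms(1,3)] by simp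
qed

text \<open>Passing from times \<open>a + k\<close>, \<open>b + k\<close> to the later times \<open>a + m\<close>, \<open>b + m\<close> decreases the distance,
  and for a return time \<open>m\<close> the points at these times are almost those at \<open>a\<close> and \<open>b\<close> again.  So \<open>f\<close>
  cannot have lost any distance along the orbit.\<close>

lemma (in Metric_space) nonexpansive_isometric_on_recurrent_orbit:
  assumes "f ` M \<subseteq> M" and "nonexpansive M d f" and "p \<in> M"
    and recurrent: "\<And>\<epsilon> N. \<epsilon> > 0 \<Longrightarrow> \<exists>m\<ge>N. d ((f ^^ m) p) p < \<epsilon>"
  shows "d ((f ^^ a) p) ((f ^^ b) p) \<le> d ((f ^^ (a + k)) p) ((f ^^ (b + k)) p)"
proof (rule field_le_epsilon)
  fix e :: real assume "e > 0"
  then obtain m where m: "m \<ge> k" "d ((f ^^ m) p) p < e / 2"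
    using recurrent[of "e / 2" k] by auto
  note ne = nonexpansive_funpow[OF assms(1,2)]
  have mem: "(f ^^ n) p \<in> M" for n by (rule funpow_closed[OF assms(1,3)])
  have return: "d ((f ^^ c) p) ((f ^^ (c + m)) p) < e / 2" for c
    using ne[OF mem[of m] assms(3), of c] m(2) by (simp add: funpow_add commute)
  have "d ((f ^^ (a + m)) p) ((f ^^ (b + m)) p) \<le> d ((f ^^ (a + k)) p) ((f ^^ (b + k)) p)"
    using nonexpansive_orbit_shift[OF assms(1-3), of "a + k" "m - k" "b + k"] m(1) by simp
  then show "d ((f ^^ a) p) ((f ^^ b) p) \<le> d ((f ^^ (a + k)) p) ((f ^^ (b + k)) p) + e"
    using return[of a] return[of b] triangle[OF mem[of a] mem[of "a + m"] mem[of b]]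
      triangle[OF mem[of "a + m"] mem[of "b + m"] mem[of b]] commute[of "(f ^^ b) p" "(f ^^ (b + m)) p"]
    by linarith
qed

text \<open>The times \<open>T\<close> at which the orbit is within distance 2 of \<open>p\<close> turn out to have bounded gaps;
  between two such times the orbit can travel only a bounded distance.  To bound the gaps, cover the
  orbit points with times in \<open>T\<close> by finitely many unit balls around points \<open>f\<^sup>c p\<close>, and fix a return
  time \<open>m\<close> beyond all these \<open>c\<close>.  If \<open>f\<^sup>n p\<close> is in the ball around \<open>f\<^sup>c p\<close>, then so is \<open>f\<^bsup>n + m\<^esup> p\<close>, up
  to an error below 1; undoing \<open>c\<close> steps, on which \<open>f\<close> is isometric, gives \<open>n + m - c \<in> T\<close>.\<close>

lemma (in Metric_space) recurrent_orbit_bounded: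
  assumes f: "f ` M \<subseteq> M" "nonexpansive M d f"
    and proper: "\<And>\<sigma> :: nat \<Rightarrow> 'a. range \<sigma> \<subseteq> f ` M \<Longrightarrow> mbounded (range \<sigma>) \<Longrightarrow>
        \<exists>r l. strict_mono r \<and> limitin mtopology (\<sigma> \<circ> r) l sequentially"
    and p: "p \<in> M"
    and recurrent: "\<And>\<epsilon> N. \<epsilon> > 0 \<Longrightarrow> \<exists>m\<ge>N. d ((f ^^ m) p) p < \<epsilon>"
  shows "\<exists>B. \<forall>n. d ((f ^^ n) p) p \<le> B"
proof -
  note ne = nonexpansive_funpow[OF f]
  have mem: "(f ^^ n) p \<in> M" for n by (rule funpow_closed[OF f(1) p])
  note iso = nonexpansive_isometric_on_recurrent_orbit[OF f p recurrent]
  define T where "T = {n. d ((f ^^ n) p) p < 2}"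
  \<comment> \<open>Time 0 is left out since \<open>p\<close> need not lie in the image of \<open>f\<close>.\<close>
  let ?S = "(\<lambda>n. (f ^^ n) p) ` (T - {0})"
  have S_f: "?S \<subseteq> f ` M"
  proof
    fix y assume "y \<in> ?S"
    then obtain n where "n \<noteq> 0" "y = (f ^^ n) p" by blast
    then show "y \<in> f ` M" using mem[of "n - 1"] by (cases n) auto
  qed
  have S_ball: "?S \<subseteq> mcball p 2"
    using p mem by (auto simp: T_def commute)
  have "mtotally_bounded ?S"
    unfolding mtotally_bounded_sequentially
  proof (intro conjI allI impI)
    show "?S \<subseteq> M" using mem by auto
    fix \<sigma> :: "nat \<Rightarrow> 'a" assume \<sigma>: "range \<sigma> \<subseteq> ?S"
    then have "mbounded (range \<sigma>)" "range \<sigma> \<subseteq> f ` M"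
      using S_ball S_f unfolding mbounded_def by blast+
    from proper[OF this(2,1)] obtain r l where r: "strict_mono r"
      "limitin mtopology (\<sigma> \<circ> r) l sequentially" by blast
    have "range (\<sigma> \<circ> r) \<subseteq> M" using subset_trans[OF \<sigma> \<open>?S \<subseteq> M\<close>] by auto
    then show "\<exists>r. strict_mono r \<and> MCauchy (\<sigma> \<circ> r)"
      using convergent_imp_MCauchy r by blast
  qed
  then obtain K where "finite K" "K \<subseteq> ?S" and cover: "?S \<subseteq> (\<Union>x\<in>K. mball x 1)"
    unfolding mtotally_bounded_def by (meson zero_less_one)
  then obtain F where F: "finite F" "K = (\<lambda>n. (f ^^ n) p) ` F"
    by (meson finite_subset_image)
  obtain m where m: "m \<ge> Suc (Max (insert 0 F))" "d ((f ^^ m) p) p < 1"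
    using recurrent[of 1] by auto
  have F_less: "c < m" if "c \<in> insert 0 F" for c
  proof -
    have "c \<le> Max (insert 0 F)" using that F(1) by (intro Max_ge) auto
    then show ?thesis using m(1) by linarith
  qed
  have gap: "\<exists>n'\<in>T. n < n' \<and> n' \<le> n + m" if n: "n \<in> T" for n
  proof -
    have "\<exists>c\<in>insert 0 F. d ((f ^^ n) p) ((f ^^ c) p) < 1"
    proof (cases "n = 0")
      case False
      then have "(f ^^ n) p \<in> ?S" using n by blast
      then show ?thesis using cover F(2) by (force simp: commute)
    qed (use p in auto)
    then obtain c where c: "c \<in> insert 0 F" "d ((f ^^ n) p) ((f ^^ c) p) < 1" by blast
    let ?n = "n + (m - c)"
    have "c < m" by (rule F_less[OF c(1)])
    have "d ((f ^^ ?n) p) p \<le> d ((f ^^ (n + m)) p) ((f ^^ c) p)"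
      using iso[of ?n 0 c] \<open>c < m\<close> by simp
    also have "\<dots> \<le> d ((f ^^ (n + m)) p) ((f ^^ n) p) + d ((f ^^ n) p) ((f ^^ c) p)"
      by (rule triangle) (rule mem)+
    also have "d ((f ^^ (n + m)) p) ((f ^^ n) p) \<le> d ((f ^^ m) p) p"
      using ne[OF mem[of m] p, of n] by (simp add: funpow_add)
    finally have "?n \<in> T" using c(2) m(2) by (simp add: T_def)
    then show ?thesis using \<open>c < m\<close> by (intro bexI[of _ ?n]) auto
  qed
  have near: "\<exists>n\<in>T. n \<le> k \<and> k < n + m" for k
  proof (induction k)
    case 0
    then show ?case using F_less[of 0] p by (intro bexI[of _ 0]) (auto simp: T_def)
  next
    case (Suc k)
    then obtain n where n: "n \<in> T" "n \<le> k" "k < n + m" by blast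
    show ?case
    proof (cases "Suc k < n + m")
      case False
      then obtain n' where "n' \<in> T" "n < n'" "n' \<le> n + m" using gap[OF n(1)] by blast
      then show ?thesis using n False by (intro bexI[of _ n']) auto
    next
      case True
      then show ?thesis using n by (intro bexI[of _ n]) auto
    qed
  qed
  let ?B = "Max ((\<lambda>j. d ((f ^^ j) p) p) ` {..m})"
  have "d ((f ^^ k) p) p \<le> ?B + 2" for k
  proof -
    obtain n where n: "n \<in> T" "n \<le> k" "k < n + m" using near by blast
    have "d ((f ^^ k) p) p \<le> d ((f ^^ k) p) ((f ^^ n) p) + d ((f ^^ n) p) p"
      by (rule triangle) (use mem p in auto)
    moreover have "d ((f ^^ k) p) ((f ^^ n) p) \<le> d ((f ^^ (k - n)) p) p"
      using nonexpansive_orbit_shift[OF f p, of "k - n" n 0] n(2) by simp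
    moreover have "d ((f ^^ (k - n)) p) p \<le> ?B"
      using n by (intro Max_ge) auto
    ultimately show ?thesis using n(1) by (simp add: T_def)
  qed
  then show ?thesis by blast
qed

text \<open>Calka's theorem.  If the distances do not tend to infinity, the orbit has a convergent
  subsequence.  Its limit \<open>p\<close> is recurrent: the difference \<open>m\<close> of two late times of the subsequence
  carries a point near \<open>p\<close> to a point near \<open>p\<close>, hence carries \<open>p\<close> itself near to \<open>p\<close>.  The orbit of
  \<open>p\<close> is therefore bounded, and the orbit of \<open>x\<close> stays within \<open>d x p\<close> of it.\<close>

lemma (in Metric_space) nonexpansive_orbit_bounded_or_divergent:
  assumes f: "f ` M \<subseteq> M" "nonexpansive M d f"
    and proper: "\<And>\<sigma> :: nat \<Rightarrow> 'a. range \<sigma> \<subseteq> f ` M \<Longrightarrow> mbounded (range \<sigma>) \<Longrightarrow>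
        \<exists>r l. strict_mono r \<and> limitin mtopology (\<sigma> \<circ> r) l sequentially"
    and x: "x \<in> M"
  shows "mbounded (orbit f x) \<or> filterlim (\<lambda>n. d ((f ^^ n) x) x) at_top sequentially"
proof (rule disjCI)
  note ne = nonexpansive_funpow[OF f]
  have mem: "(f ^^ n) x \<in> M" for n by (rule funpow_closed[OF f(1) x])
  assume "\<not> filterlim (\<lambda>n. d ((f ^^ n) x) x) at_top sequentially"
  then obtain Z where Z: "\<not> (\<forall>\<^sub>F n in sequentially. Z \<le> d ((f ^^ n) x) x)"
    unfolding filterlim_at_top by blast
  obtain r :: "nat \<Rightarrow> nat" where r: "strict_mono r" "\<And>n. d ((f ^^ r n) x) x < Z"
    using not_eventually_sequentiallyD[OF Z] unfolding not_le by blast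
  \<comment> \<open>\<open>r 0\<close> may be 0, and then \<open>x\<close> need not lie in the image of \<open>f\<close>.\<close>
  let ?\<sigma> = "\<lambda>n. (f ^^ r (Suc n)) x"
  have "range ?\<sigma> \<subseteq> f ` M"
  proof clarify
    fix n
    have "r (Suc n) \<ge> Suc n" using r(1) strict_mono_imp_increasing by blast
    then show "(f ^^ r (Suc n)) x \<in> f ` M"
      using mem[of "r (Suc n) - 1"] by (cases "r (Suc n)") auto
  qed
  moreover have "range ?\<sigma> \<subseteq> mcball x Z"
    using r(2) x mem by (auto simp: commute less_imp_le)
  then have "mbounded (range ?\<sigma>)" unfolding mbounded_def by blast
  ultimately obtain s p where s: "strict_mono s" "limitin mtopology (?\<sigma> \<circ> s) p sequentially"
    using proper by blast
  define u where "u = r \<circ> Suc \<circ> s"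
  have u: "strict_mono u" unfolding u_def
    by (intro strict_mono_o r s) (auto simp: strict_mono_def)
  have p: "p \<in> M" and lim: "\<And>\<epsilon>. \<epsilon> > 0 \<Longrightarrow> \<forall>\<^sub>F n in sequentially. d ((f ^^ u n) x) p < \<epsilon>"
    using s(2) limitin_eventually_dist_less[OF s(2)] limitin_topspace[OF s(2)] by (auto simp: u_def)
  have recurrent: "\<exists>m\<ge>N. d ((f ^^ m) p) p < \<epsilon>" if "\<epsilon> > 0" for \<epsilon> N
  proof -
    from \<open>\<epsilon> > 0\<close> obtain n where n: "\<And>k. k \<ge> n \<Longrightarrow> d ((f ^^ u k) x) p < \<epsilon> / 2"
      using lim[of "\<epsilon> / 2"] unfolding eventually_sequentially by (meson half_gt_zero)
    have "u n + N \<le> u (n + N)"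
    proof (induction N)
      case (Suc N)
      then show ?case using strict_monoD[OF u, of "n + N" "n + Suc N"] by simp
    qed simp
    define m where "m = u (n + N) - u n"
    have "m \<ge> N" and um: "u (n + N) = m + u n" using \<open>u n + N \<le> u (n + N)\<close> by (auto simp: m_def)
    have "d ((f ^^ m) p) ((f ^^ u (n + N)) x) \<le> d p ((f ^^ u n) x)"
      using ne[OF p mem[of "u n"], of m] by (simp add: um funpow_add)
    also have "\<dots> < \<epsilon> / 2" using n[of n] by (simp add: commute)
    finally have "d ((f ^^ m) p) p < \<epsilon>"
      using n[of "n + N"] triangle[OF funpow_closed[OF f(1) p, of m] mem[of "u (n + N)"] p] by simp
    then show ?thesis using \<open>m \<ge> N\<close> by blast
  qed
  obtain B where B: "\<And>n. d ((f ^^ n) p) p \<le> B"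
    using recurrent_orbit_bounded[OF f proper p recurrent] by blast
  have "orbit f x \<subseteq> mcball p (d x p + B)"
  proof
    fix y assume "y \<in> orbit f x"
    then obtain n where y: "y = (f ^^ n) x" by (auto simp: orbit_def)
    have "d y p \<le> d y ((f ^^ n) p) + d ((f ^^ n) p) p"
      unfolding y by (rule triangle) (use mem p funpow_closed[OF f(1)] in auto)
    then show "y \<in> mcball p (d x p + B)"
      using ne[OF x p, of n] B[of n] p mem[of n] by (simp add: y commute)
  qed
  then show "mbounded (orbit f x)" unfolding mbounded_def by blast
qed

section \<open>Limits of sequences in the image of the map\<close>

locale compact_nonexpansive = Metric_space Y d + B: Metric_space Yb db
  for Y :: "'a set" and d and Yb :: "'a set" and db +
  fixes f :: "'a \<Rightarrow> 'a"
  assumes axiom1: "axiom1 Y d Yb db"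
    and axiom3: "axiom3 Y d Yb db"
    and self_map: "f ` Y \<subseteq> Y"
    and compact_mapping: "compact_mapping Y Yb db f"
    and nonexpansive: "nonexpansive Y d f"
begin

lemmas funpow_nonexpansive = nonexpansive_funpow[OF self_map nonexpansive]

lemmas funpow_mem = funpow_closed[OF self_map]

lemma funpow_Suc_mem_image: "x \<in> Y \<Longrightarrow> (f ^^ Suc n) x \<in> f ` Y"
  using funpow_mem by simp

lemma subset_closure: "Y \<subseteq> Yb"
proof -
  have "openin B.mtopology Y" using axiom1 unfolding axiom1_def by blast
  then show ?thesis using openin_subset by force
qed

lemma limitin_interior:
  assumes "\<And>n. x n \<in> Y" and "l \<in> Y" and "limitin B.mtopology x l sequentially"
  shows "limitin mtopology x l sequentially"
proof -
  have "mtopology = subtopology B.mtopology Y"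
    using axiom1 unfolding axiom1_def by metis
  then show ?thesis using assms by (simp add: limitin_subtopology)
qed

lemma convergent_subsequence:
  assumes "\<And>n::nat. x n \<in> f ` Y"
  obtains r l where "strict_mono r" "l \<in> Yb" "limitin B.mtopology (x \<circ> r) l sequentially"
proof -
  let ?C = "B.mtopology closure_of (f ` Y)"
  have "f ` Y \<subseteq> topspace B.mtopology"
    using self_map subset_closure by auto
  then have "range x \<subseteq> ?C"
    using assms closure_of_subset by blast
  moreover have "compactin B.mtopology ?C"
    using compact_mapping unfolding compact_mapping_def .
  ultimately obtain r l where "l \<in> ?C" "strict_mono r" "limitin B.mtopology (x \<circ> r) l sequentially"
    unfolding B.compactin_sequentially by blast
  moreover have "l \<in> Yb" using limitin_topspace[OF calculation(3)] by simp
  ultimately show thesis using that by blast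
qed

lemma escaping_limit_in_boundary:
  assumes "\<And>n. x n \<in> Y" and "w \<in> Y"
    and div: "filterlim (\<lambda>n. d (x n) w) at_top sequentially"
    and lim: "limitin B.mtopology x l sequentially"
  shows "l \<in> Yb - Y"
proof (rule ccontr)
  assume "l \<notin> Yb - Y"
  moreover have "l \<in> Yb" using limitin_topspace[OF lim] by simp
  ultimately have l: "l \<in> Y" by blast
  have "limitin mtopology x l sequentially"
    using limitin_interior assms(1) l lim by blast
  then have "\<forall>\<^sub>F n in sequentially. d (x n) l < 1"
    by (rule limitin_eventually_dist_less) simp
  moreover have "\<forall>\<^sub>F n in sequentially. d l w + 1 \<le> d (x n) w"
    using div unfolding filterlim_at_top by blast
  ultimately have "\<forall>\<^sub>F n in sequentially. False"
  proof eventually_elim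
    case (elim n)
    then show False using triangle[OF assms(1)[of n] l assms(2)] by simp
  qed
  then show False by simp
qed

lemma boundary_limit_escapes:
  assumes "\<And>n. x n \<in> Y" and "w \<in> Y" and "\<xi> \<in> Yb - Y"
    and "limitin B.mtopology x \<xi> sequentially"
  shows "filterlim (\<lambda>n. d (x n) w) at_top sequentially"
  using axiom1[unfolded axiom1_def, THEN conjunct2, THEN conjunct2, THEN conjunct2, rule_format]
    assms by (metis image_subsetI)

lemma limitin_of_unique_subsequential_limit:
  assumes x: "\<And>n::nat. x n \<in> f ` Y" and \<xi>: "\<xi> \<in> Yb"
    and uniq: "\<And>r l. strict_mono r \<Longrightarrow> limitin B.mtopology (x \<circ> r) l sequentially \<Longrightarrow> l = \<xi>"
  shows "limitin B.mtopology x \<xi> sequentially"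
proof (rule ccontr)
  have xb: "x n \<in> Yb" for n using x self_map subset_closure by blast
  assume "\<not> limitin B.mtopology x \<xi> sequentially"
  then obtain \<epsilon> where "\<epsilon> > 0" "\<not> (\<forall>\<^sub>F n in sequentially. db (x n) \<xi> < \<epsilon>)"
    using \<xi> xb by (auto simp: B.limitin_metric)
  then obtain r :: "nat \<Rightarrow> nat" where r: "strict_mono r" "\<And>n. \<not> db (x (r n)) \<xi> < \<epsilon>"
    by (auto dest: not_eventually_sequentiallyD)
  obtain s l where s: "strict_mono s" "limitin B.mtopology ((\<lambda>n. x (r n)) \<circ> s) l sequentially"
    using convergent_subsequence[of "\<lambda>n. x (r n)"] x by blast
  have "l = \<xi>" using uniq[OF strict_mono_o[OF r(1) s(1)]] s(2) by (simp add: o_def)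
  then have "\<forall>\<^sub>F n in sequentially. db (x (r (s n))) \<xi> < \<epsilon>"
    using B.limitin_eventually_dist_less[OF s(2) \<open>\<epsilon> > 0\<close>] by simp
  then show False using r(2) by simp
qed

text \<open>By the triangle inequality \<open>d (y n) w \<ge> d (x n) w - d (x n) (y n)\<close>, so \<open>y\<close> escapes to infinity
  and all its subsequential limits are on the boundary, as Axiom 3' requires.\<close>

lemma image_sequence_follows:
  assumes x: "\<And>n. x n \<in> Y" and y: "\<And>n. y n \<in> f ` Y" and w: "w \<in> Y"
    and \<xi>: "\<xi> \<in> Yb - Y" and lim: "limitin B.mtopology x \<xi> sequentially"
    and close: "filterlim (\<lambda>n. d (x n) (y n) - d (x n) w) at_bot sequentially"
  shows "limitin B.mtopology y \<xi> sequentially"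
proof (rule limitin_of_unique_subsequential_limit[OF y])
  show "\<xi> \<in> Yb" using \<xi> by blast
  fix r :: "nat \<Rightarrow> nat" and l
  assume r: "strict_mono r" and l: "limitin B.mtopology (y \<circ> r) l sequentially"
  have yY: "y n \<in> Y" for n using y self_map by blast
  have sub: "filterlim r sequentially sequentially" by (rule filterlim_subseq[OF r])
  have close': "filterlim (\<lambda>n. d (x (r n)) (y (r n)) - d (x (r n)) w) at_bot sequentially"
    using filterlim_compose[OF close sub] .
  have "filterlim (\<lambda>n. - (d (x (r n)) (y (r n)) - d (x (r n)) w)) at_top sequentially"
    using close' by (simp add: filterlim_uminus_at_top)
  then have "filterlim (\<lambda>n. d (y (r n)) w) at_top sequentially"
  proof (rule filterlim_at_top_mono, intro always_eventually allI)
    fix n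
    show "- (d (x (r n)) (y (r n)) - d (x (r n)) w) \<le> d (y (r n)) w"
      using triangle[OF x[of "r n"] yY[of "r n"] w] by simp
  qed
  then have "l \<in> Yb - Y"
    using escaping_limit_in_boundary[of "y \<circ> r"] yY w l by auto
  moreover have "limitin B.mtopology (x \<circ> r) \<xi> sequentially"
    using limitin_subsequence[OF r lim] .
  ultimately show "l = \<xi>"
    using axiom3[unfolded axiom3_def, rule_format, of l \<xi> "y \<circ> r" "x \<circ> r"] \<xi> l x yY w close'
    by (auto simp: commute)
qed

text \<open>The closure in \<open>Yb\<close> of a bounded part of the image is compact and, by Axiom 1', does not meet
  the boundary.  This is the local compactness which Calka's theorem asks for.\<close>

lemma bounded_image_sequence_converges:
  assumes "range \<sigma> \<subseteq> f ` Y" and bdd: "mbounded (range \<sigma>)"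
  shows "\<exists>r l. strict_mono (r :: nat \<Rightarrow> nat) \<and> limitin mtopology (\<sigma> \<circ> r) l sequentially"
proof -
  obtain r l where r: "strict_mono (r :: nat \<Rightarrow> nat)" "l \<in> Yb"
    "limitin B.mtopology (\<sigma> \<circ> r) l sequentially"
    using convergent_subsequence[of \<sigma>] assms(1) by blast
  have \<sigma>Y: "\<sigma> n \<in> Y" for n using assms(1) self_map by blast
  obtain w b where w: "range \<sigma> \<subseteq> mcball w b" "w \<in> Y"
    using bdd \<sigma>Y unfolding mbounded_def by (metis in_mcball rangeI subsetD)
  have "l \<in> Y"
  proof (rule ccontr)
    assume "l \<notin> Y"
    then have "l \<in> Yb - Y" using r(2) by blast
    then have "filterlim (\<lambda>n. d ((\<sigma> \<circ> r) n) w) at_top sequentially"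
      using \<sigma>Y by (intro boundary_limit_escapes[OF _ w(2) _ r(3)]) auto
    then have "\<forall>\<^sub>F n in sequentially. b + 1 \<le> d (\<sigma> (r n)) w"
      unfolding filterlim_at_top by simp
    then obtain n where "b + 1 \<le> d (\<sigma> (r n)) w"
      by (auto simp: eventually_sequentially)
    moreover have "\<sigma> (r n) \<in> mcball w b" using w(1) by blast
    ultimately show False by (simp add: commute)
  qed
  then show ?thesis using limitin_interior[of "\<sigma> \<circ> r" l] \<sigma>Y r by auto
qed

section \<open>Gromov products and the limit of an orbit\<close>

text \<open>If \<open>g\<close> is the Gromov product, then \<open>(d x w - g) + (d y w - g) = d x y\<close>.  So the point at
  distance \<open>d x w - g\<close> from \<open>x\<close> along a geodesic to \<open>y\<close> would have distance \<open>d y w - g\<close> from \<open>y\<close>; a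
  quasi-geodesic costs at most \<open>2 * \<kappa>\<close>.  All inequalities are doubled to avoid fractions.\<close>

lemma quasi_geodesic_point:
  assumes qg: "quasi_geodesic_space Y d \<kappa>" and "x \<in> Y" "y \<in> Y" "w \<in> Y"
  obtains z where "z \<in> Y"
    "2 * d x z \<le> 2 * d x w - (d x w + d y w - d x y) + 4 * \<kappa>"
    "2 * d y z \<le> 2 * d y w - (d x w + d y w - d x y) + 4 * \<kappa>"
proof -
  obtain a b \<gamma> where \<gamma>: "quasi_geodesic Y d \<kappa> a b \<gamma>" "\<gamma> a = x" "\<gamma> b = y"
    using qg assms(2,3) unfolding quasi_geodesic_space_def by blast
  define s where "s = (d x w - d y w + d x y) / 2"
  \<comment> \<open>The parameter interval can be shorter than \<open>d x y\<close> by up to \<open>\<kappa>\<close>, so \<open>a + s\<close> may overshoot \<open>b\<close>.\<close>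
  define t where "t = min (a + s) b"
  have s: "0 \<le> s" "s \<le> d x y"
    using triangle[OF assms(3,2,4)] triangle[OF assms(2,3,4)] commute[of y x] by (auto simp: s_def)
  have ab: "a \<le> b" and in_Y: "\<And>t. t \<in> {a..b} \<Longrightarrow> \<gamma> t \<in> Y"
    and qgd: "\<And>t t'. t \<in> {a..b} \<Longrightarrow> t' \<in> {a..b} \<Longrightarrow>
      \<bar>t - t'\<bar> - \<kappa> \<le> d (\<gamma> t) (\<gamma> t') \<and> d (\<gamma> t) (\<gamma> t') \<le> \<bar>t - t'\<bar> + \<kappa>"
    using \<gamma>(1) unfolding quasi_geodesic_def by auto
  have t: "t \<in> {a..b}" using s ab by (auto simp: t_def)
  have "b - a - \<kappa> \<le> d x y" "d x (\<gamma> t) \<le> t - a + \<kappa>" "d y (\<gamma> t) \<le> b - t + \<kappa>" "0 \<le> \<kappa>"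
    using qgd[of a b] qgd[of a t] qgd[of b t] qgd[of a a] ab t \<gamma>(2,3) by auto
  then have "d x (\<gamma> t) \<le> s + \<kappa>" "d y (\<gamma> t) \<le> d x y - s + 2 * \<kappa>"
    using s by (auto simp: t_def min_def split: if_splits)
  then show thesis
    using that[OF in_Y[OF t]] \<open>0 \<le> \<kappa>\<close> by (simp add: s_def field_simps)
qed

text \<open>The points \<open>z n\<close> of the preceding lemma need not lie in the image of \<open>f\<close>, so they may have no
  limit points; the argument uses \<open>f (z n)\<close> instead.  Bounded displacement ensures that
  \<open>d (x n) (f (z n))\<close> exceeds \<open>d (x n) (z n)\<close> by at most a constant, so that \<open>f (z n)\<close> follows both
  sequences.\<close>

lemma gromov_product_unbounded_imp_same_limit:
  assumes qg: "quasi_geodesic_space Y d \<kappa>"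
    and x: "\<And>n. x n \<in> Y" and y: "\<And>n. y n \<in> Y" and w: "w \<in> Y"
    and \<xi>: "\<xi> \<in> Yb - Y" "limitin B.mtopology x \<xi> sequentially"
    and \<eta>: "\<eta> \<in> Yb - Y" "limitin B.mtopology y \<eta> sequentially"
    and displacement: "\<And>n. d (x n) (f (x n)) \<le> C" "\<And>n. d (y n) (f (y n)) \<le> C"
    and gromov: "filterlim (\<lambda>n. d (x n) w + d (y n) w - d (x n) (y n)) at_top sequentially"
  shows "\<xi> = \<eta>"
proof -
  let ?g = "\<lambda>n. d (x n) w + d (y n) w - d (x n) (y n)"
  have "\<exists>z. z \<in> Y \<and> 2 * d (x n) z \<le> 2 * d (x n) w - ?g n + 4 * \<kappa> \<and>
      2 * d (y n) z \<le> 2 * d (y n) w - ?g n + 4 * \<kappa>" for n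
    using quasi_geodesic_point[OF qg x[of n] y[of n] w] by metis
  then obtain z where z: "\<And>n. z n \<in> Y"
    "\<And>n. 2 * d (x n) (z n) \<le> 2 * d (x n) w - ?g n + 4 * \<kappa>"
    "\<And>n. 2 * d (y n) (z n) \<le> 2 * d (y n) w - ?g n + 4 * \<kappa>" by metis
  have follows: "limitin B.mtopology (\<lambda>n. f (z n)) \<zeta> sequentially"
    if u: "\<And>n. u n \<in> Y" and \<zeta>: "\<zeta> \<in> Yb - Y" "limitin B.mtopology u \<zeta> sequentially"
      and disp: "\<And>n. d (u n) (f (u n)) \<le> C"
      and uz: "\<And>n. 2 * d (u n) (z n) \<le> 2 * d (u n) w - ?g n + 4 * \<kappa>" for u \<zeta>
  proof (rule image_sequence_follows[OF u _ w \<zeta>])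
    show "f (z n) \<in> f ` Y" for n using z(1) by blast
    have bound: "- (C + 2 * \<kappa>) + ?g n * (1/2) \<le> - (d (u n) (f (z n)) - d (u n) w)" for n
    proof -
      have "d (u n) (f (z n)) \<le> d (u n) (f (u n)) + d (f (u n)) (f (z n))"
        by (rule triangle) (use u z(1) self_map in auto)
      moreover have "d (f (u n)) (f (z n)) \<le> d (u n) (z n)"
        using nonexpansive u z(1) unfolding nonexpansive_def by blast
      ultimately show ?thesis using disp[of n] uz[of n] by (simp add: field_simps)
    qed
    have "filterlim (\<lambda>n. - (C + 2 * \<kappa>) + ?g n * (1/2)) at_top sequentially"
      by (intro filterlim_tendsto_add_at_top[OF tendsto_const]
          filterlim_at_top_mult_tendsto_pos[OF tendsto_const _ gromov]) auto
    then have "filterlim (\<lambda>n. - (d (u n) (f (z n)) - d (u n) w)) at_top sequentially"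
      by (rule filterlim_at_top_mono) (intro always_eventually allI bound)
    then show "filterlim (\<lambda>n. d (u n) (f (z n)) - d (u n) w) at_bot sequentially"
      by (simp add: filterlim_uminus_at_top)
  qed
  show ?thesis
    using B.limitin_metric_unique[OF follows[OF x \<xi> displacement(1) z(2)]
      follows[OF y \<eta> displacement(2) z(3)]] by simp
qed

text \<open>The limit \<open>\<xi>\<close> is taken along a subsequence of record times of the distance from \<open>x\<close>.  Another
  subsequence \<open>u\<close> of times is compared with record times \<open>v j > u j\<close> from the chosen subsequence;
  the Gromov products are then at least \<open>d (f\<^bsup>u j\<^esup> x) x / 2\<close>.\<close>

lemma orbit_converges_to_boundary:
  assumes qg: "quasi_geodesic_space Y d \<kappa>" and x: "x \<in> Y"
    and div: "filterlim (\<lambda>n. d ((f ^^ n) x) x) at_top sequentially"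
  obtains \<xi> where "\<xi> \<in> Yb - Y" "limitin B.mtopology (\<lambda>n. (f ^^ Suc n) x) \<xi> sequentially"
proof -
  define a where "a n = d ((f ^^ n) x) x" for n
  have div': "filterlim a at_top sequentially" using div by (simp add: a_def[abs_def])
  note mem = funpow_mem[OF x]
  have step: "d ((f ^^ n) x) (f ((f ^^ n) x)) \<le> d x (f x)" for n
    using funpow_nonexpansive[OF x, of "f x" n] x self_map by (simp add: funpow_swap1 image_subset_iff)
  have "\<exists>N>k. \<forall>m<N. a m \<le> a N" for k
  proof -
    \<comment> \<open>The first time at which \<open>a\<close> exceeds its values up to time \<open>k\<close> is a record.\<close>
    let ?P = "\<lambda>N. a N > Max (a ` {..k})"
    have "\<forall>\<^sub>F N in sequentially. ?P N" using div' unfolding filterlim_at_top_dense by blast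
    then have ex: "\<exists>N. ?P N" by (auto simp: eventually_sequentially)
    have P: "?P (LEAST N. ?P N)" by (rule LeastI_ex[OF ex])
    have "a m \<le> Max (a ` {..k})" if "m < (LEAST N. ?P N)" for m
      using not_less_Least[OF that] unfolding not_less .
    then have "\<forall>m<(LEAST N. ?P N). a m \<le> a (LEAST N. ?P N)" using P by (meson less_imp_le le_less_trans)
    moreover have "(LEAST N. ?P N) > k"
    proof (rule ccontr)
      assume "\<not> (LEAST N. ?P N) > k"
      then have "a (LEAST N. ?P N) \<le> Max (a ` {..k})" by (intro Max_ge) auto
      with P show False by (meson not_less)
    qed
    ultimately show ?thesis by blast
  qed
  then obtain N where N: "\<And>k. N k > k" "\<And>k m. m < N k \<Longrightarrow> a m \<le> a (N k)" by metis
  have N_image: "(f ^^ N k) x \<in> f ` Y" for k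
    using funpow_Suc_mem_image[OF x, of "N k - 1"] N(1)[of k] by simp
  obtain r \<xi> where r: "strict_mono r" and "\<xi> \<in> Yb"
    and \<xi>lim: "limitin B.mtopology ((\<lambda>k. (f ^^ N k) x) \<circ> r) \<xi> sequentially"
    by (rule convergent_subsequence[OF N_image])
  have r_ge: "k \<le> r k" for k using r strict_mono_imp_increasing by blast
  have "filterlim (\<lambda>k. N (r k)) at_top sequentially"
  proof (rule filterlim_at_top_mono[OF filterlim_ident], intro always_eventually allI)
    show "k \<le> N (r k)" for k using N(1)[of "r k"] r_ge[of k] by simp
  qed
  then have "filterlim (\<lambda>k. d ((f ^^ N (r k)) x) x) at_top sequentially"
    using filterlim_compose[OF div] by blast
  then have \<xi>: "\<xi> \<in> Yb - Y"
    using escaping_limit_in_boundary[OF _ x _ \<xi>lim] mem by simp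
  have "limitin B.mtopology (\<lambda>n. (f ^^ Suc n) x) \<xi> sequentially"
  proof (rule limitin_of_unique_subsequential_limit)
    show "(f ^^ Suc n) x \<in> f ` Y" for n by (rule funpow_Suc_mem_image[OF x])
    show "\<xi> \<in> Yb" using \<xi> by blast
    fix s :: "nat \<Rightarrow> nat" and \<eta>
    assume s: "strict_mono s" and \<eta>lim: "limitin B.mtopology ((\<lambda>n. (f ^^ Suc n) x) \<circ> s) \<eta> sequentially"
    define u where "u j = Suc (s j)" for j
    have u: "strict_mono u" using s by (simp add: u_def strict_mono_def)
    \<comment> \<open>\<open>N (r (u j)) > r (u j) \<ge> u j\<close>, and \<open>v\<close> still runs along the subsequence converging to \<open>\<xi>\<close>.\<close>
    define v where "v j = N (r (u j))" for j
    have "filterlim (\<lambda>j. a (u j)) at_top sequentially"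
      using filterlim_compose[OF div' filterlim_subseq[OF u]] .
    then have au: "filterlim (\<lambda>j. d ((f ^^ u j) x) x) at_top sequentially" by (simp add: a_def)
    have \<eta>lim': "limitin B.mtopology (\<lambda>j. (f ^^ u j) x) \<eta> sequentially"
      using \<eta>lim by (simp add: u_def o_def)
    have \<eta>: "\<eta> \<in> Yb - Y" using escaping_limit_in_boundary[OF _ x au \<eta>lim'] mem by blast
    have vlim: "limitin B.mtopology (\<lambda>j. (f ^^ v j) x) \<xi> sequentially"
      using limitin_subsequence[OF u \<xi>lim] by (simp add: v_def o_def)
    have "a (u j) \<le> d ((f ^^ v j) x) x + d ((f ^^ u j) x) x - d ((f ^^ v j) x) ((f ^^ u j) x)" for j
    proof -
      have uv: "u j < v j" using r_ge[of "u j"] N(1)[of "r (u j)"] by (simp add: v_def)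
      have "d ((f ^^ v j) x) ((f ^^ u j) x) \<le> a (v j - u j)"
        using nonexpansive_orbit_shift[OF self_map nonexpansive x, of "v j - u j" "u j" 0] uv
        by (simp add: a_def)
      also have "\<dots> \<le> a (v j)" using N(2)[of "v j - u j" "r (u j)"] uv by (simp add: v_def u_def)
      finally show ?thesis by (simp add: a_def)
    qed
    then have "filterlim (\<lambda>j. d ((f ^^ v j) x) x + d ((f ^^ u j) x) x
        - d ((f ^^ v j) x) ((f ^^ u j) x)) at_top sequentially"
      using filterlim_at_top_mono[OF au] by (simp add: a_def)
    then show "\<eta> = \<xi>"
      using gromov_product_unbounded_imp_same_limit[OF qg mem mem x \<xi> vlim \<eta> \<eta>lim' step step]
      by simp
  qed
  then show thesis using that \<xi> by blast
qed

text \<open>If uniformity failed, there would be starting points \<open>y n\<close> in a bounded set whose iterates at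
  times tending to infinity keep away from \<open>\<xi>\<close>.  But these iterates are within bounded distance of
  those of \<open>x\<close>, which tend to \<open>\<xi>\<close> and escape to infinity, so they tend to \<open>\<xi>\<close> too.\<close>

lemma uniform_convergence_on_bounded:
  assumes x: "x \<in> Y" and \<xi>: "\<xi> \<in> Yb - Y"
    and lim: "limitin B.mtopology (\<lambda>n. (f ^^ Suc n) x) \<xi> sequentially"
  shows "iterates_converge_uniformly_on_bounded Y d db f \<xi>"
  unfolding iterates_converge_uniformly_on_bounded_def
proof (intro allI impI)
  fix K assume "mbounded K"
  then have "mbounded (insert x K)" using x by (simp add: mbounded_insert)
  then obtain b where b: "\<And>y. y \<in> K \<Longrightarrow> y \<in> Y \<and> d x y \<le> b"
    unfolding mbounded_alt by blast
  have small: "\<forall>\<^sub>F n in sequentially. \<forall>y\<in>K. db ((f ^^ Suc n) y) \<xi> < \<epsilon>" if "\<epsilon> > 0" for \<epsilon>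
  proof (rule ccontr)
    assume "\<not> ?thesis"
    then obtain r :: "nat \<Rightarrow> nat" where r: "strict_mono r"
      "\<And>n. \<exists>y\<in>K. \<not> db ((f ^^ Suc (r n)) y) \<xi> < \<epsilon>"
      using not_eventually_sequentiallyD by blast
    then obtain y where y: "\<And>n. y n \<in> K" "\<And>n. \<not> db ((f ^^ Suc (r n)) (y n)) \<xi> < \<epsilon>" by metis
    let ?x = "\<lambda>n. (f ^^ Suc (r n)) x" and ?y = "\<lambda>n. (f ^^ Suc (r n)) (y n)"
    have xlim: "limitin B.mtopology ?x \<xi> sequentially"
      using limitin_subsequence[OF r(1) lim] by (simp add: o_def)
    have xY: "?x n \<in> Y" for n by (rule funpow_mem[OF x])
    have "filterlim (\<lambda>n. d (?x n) x) at_top sequentially"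
      by (rule boundary_limit_escapes[OF xY x \<xi> xlim])
    then have "filterlim (\<lambda>n. - b + d (?x n) x) at_top sequentially"
      by (rule filterlim_tendsto_add_at_top[OF tendsto_const])
    then have "filterlim (\<lambda>n. - (d (?x n) (?y n) - d (?x n) x)) at_top sequentially"
    proof (rule filterlim_at_top_mono, intro always_eventually allI)
      fix n
      show "- b + d (?x n) x \<le> - (d (?x n) (?y n) - d (?x n) x)"
        using funpow_nonexpansive[OF x, of "y n" "Suc (r n)"] b[OF y(1)[of n]] by simp
    qed
    then have "filterlim (\<lambda>n. d (?x n) (?y n) - d (?x n) x) at_bot sequentially"
      by (simp add: filterlim_uminus_at_top)
    moreover have "\<And>n. ?y n \<in> f ` Y" using funpow_Suc_mem_image b y(1) by blast
    ultimately have "limitin B.mtopology ?y \<xi> sequentially"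
      by (intro image_sequence_follows[OF xY _ x \<xi> xlim])
    then have "\<forall>\<^sub>F n in sequentially. db (?y n) \<xi> < \<epsilon>"
      using B.limitin_eventually_dist_less that by blast
    then show False using y(2) by simp
  qed
  have "(\<lambda>n. SUP y\<in>K. ennreal (db ((f ^^ Suc n) y) \<xi>)) \<longlonglongrightarrow> 0"
  proof (rule order_tendstoI)
    fix e :: ennreal assume "0 < e"
    then obtain \<delta> where \<delta>: "0 < \<delta>" "\<delta> < e" using dense by blast
    then obtain \<epsilon> where \<epsilon>: "\<delta> = ennreal \<epsilon>" "0 < \<epsilon>"
      by (cases \<delta>) auto
    show "\<forall>\<^sub>F n in sequentially. (SUP y\<in>K. ennreal (db ((f ^^ Suc n) y) \<xi>)) < e"
      using small[OF \<epsilon>(2)]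
    proof eventually_elim
      case (elim n)
      then have "(SUP y\<in>K. ennreal (db ((f ^^ Suc n) y) \<xi>)) \<le> ennreal \<epsilon>"
        by (intro SUP_least ennreal_leI) auto
      then show ?case using \<delta>(2) \<epsilon>(1) by simp
    qed
  qed simp
  then show "(\<lambda>n. SUP y\<in>K. ennreal (db ((f ^^ n) y) \<xi>)) \<longlonglongrightarrow> 0"
    by (rule LIMSEQ_imp_Suc)
qed

end

theorem theorem5p2:
  fixes Y Yb :: "'a set" and d db :: "'a \<Rightarrow> 'a \<Rightarrow> real" and \<kappa> :: real and f :: "'a \<Rightarrow> 'a"
  assumes "Metric_space Y d" and "Y \<noteq> {}"
    and "Metric_space Yb db"
    and "\<kappa> \<ge> 0"
    and "quasi_geodesic_space Y d \<kappa>"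
    and "axiom1 Y d Yb db"
    and "axiom3 Y d Yb db"
    and "f ` Y \<subseteq> Y"
    and "compact_mapping Y Yb db f"
    and "nonexpansive Y d f"
    and "without_bounded_orbits Y d f"
  shows "\<exists>\<xi>\<in>Yb - Y. iterates_converge_uniformly_on_bounded Y d db f \<xi>"
proof -
  interpret compact_nonexpansive Y d Yb db f
    using assms by (simp add: compact_nonexpansive_def compact_nonexpansive_axioms_def)
  obtain x where x: "x \<in> Y" using \<open>Y \<noteq> {}\<close> by blast
  have "filterlim (\<lambda>n. d ((f ^^ n) x) x) at_top sequentially"
    using nonexpansive_orbit_bounded_or_divergent[OF self_map nonexpansive
        bounded_image_sequence_converges x] assms(11) x
    unfolding without_bounded_orbits_def by blast
  then obtain \<xi> where "\<xi> \<in> Yb - Y" "limitin B.mtopology (\<lambda>n. (f ^^ Suc n) x) \<xi> sequentially"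
    using orbit_converges_to_boundary[OF assms(5) x] by blast
  then show ?thesis using uniform_convergence_on_bounded[OF x] by blast
qed

end
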